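(* Let $\mathcal U$ be an uncertainty set for a fixed machine environment, and let $\mathrm{ALG}$ be an algorithm that is $\alpha$-consistent for $\mathcal U$. Then $\mathrm{ALG}$ is $\eta^2\alpha$-smooth for $\mathcal U$: for every real $\eta\ge1$ and all scenarios $q,\hat q\in\mathcal U$ such that $\hat q$ has prediction error $\eta$ with respect to $q$, $$C_{\max}(\mathrm{ALG}(\mathcal U,\hat q),q)\le\eta^2\alpha\cdot\mathrm{OPT}(q).$$
   Context: There are $m$ machines and $n$ jobs. A scenario is a matrix $q$ of processing times $q_{i,j}\in[0,\infty]$ of job $j$ on machine $i$ (the value $\infty$ encodes ineligible machine–job pairs, which are the same in all scenarios of $\mathcal U$). A schedule is a partition $\mathcal S=(S_1,\dots,S_m)$ of $[n]$ (parts may be empty); $C_{\max}(\mathcal S,q)=\max_i\sum_{j\in S_i}q_{i,j}$ and $\mathrm{OPT}(q)=\min_{\mathcal S}C_{\max}(\mathcal S,q)$. An uncertainty set $\mathcal U$ is a set of scenarios. An algorithm $\mathrm{ALG}$ maps $(\mathcal U,\hat q)$, with predicted scenario $\hat q\in\mathcal U$, to a schedule $\mathrm{ALG}(\mathcal U,\hat q)$. It is $\alpha$-consistent for $\mathcal U$ if $C_{\max}(\mathrm{ALG}(\mathcal U,\hat q),\hat q)\le\alpha\,\mathrm{OPT}(\hat q)$ for every $\hat q\in\mathcal U$. The prediction error of $\hat q$ with respect to $q$ is $$\eta=\max_{i,j}\max\Big\{\frac{q_{i,j}}{\hat q_{i,j}},\frac{\hat q_{i,j}}{q_{i,j}}\Big\},$$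 with the conventions $0/0=1$, $x/0=\infty$ for $x>0$, and $\infty/\infty=1$. *)

theory Defs
  imports "HOL-Library.Extended_Nonnegative_Real" "HOL-Library.Disjoint_Sets"
begin

text \<open>
  Machines and jobs are indexed by finite types \<open>'i\<close> and \<open>'j\<close>, so that
  \<open>m = CARD('i) \<ge> 1\<close> and \<open>n = CARD('j) \<ge> 1\<close>; in particular all maxima and minima below
  are taken over finite nonempty sets.
\<close>

type_synonym ('i, 'j) scenario = "'i \<Rightarrow> 'j \<Rightarrow> ennreal"

type_synonym ('i, 'j) schedule = "'i \<Rightarrow> 'j set"

definition is_schedule :: "('i, 'j) schedule \<Rightarrow> bool" where
  "is_schedule S \<longleftrightarrow> disjoint_family S \<and> (\<Union>i. S i) = UNIV"

definition C_max :: "('i::finite, 'j::finite) schedule \<Rightarrow> ('i, 'j) scenario \<Rightarrow> ennreal" where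
  "C_max S q = (MAX i. \<Sum>j\<in>S i. q i j)"

definition OPT :: "('i::finite, 'j::finite) scenario \<Rightarrow> ennreal" where
  "OPT q = (MIN S\<in>{S. is_schedule S}. C_max S q)"

definition uncertainty_set :: "('i, 'j) scenario set \<Rightarrow> bool" where
  "uncertainty_set U \<longleftrightarrow> (\<forall>q\<in>U. \<forall>q'\<in>U. \<forall>i j. q i j = \<infinity> \<longleftrightarrow> q' i j = \<infinity>)"

type_synonym ('i, 'j) alg = "('i, 'j) scenario set \<Rightarrow> ('i, 'j) scenario \<Rightarrow> ('i, 'j) schedule"

definition is_algorithm :: "('i, 'j) alg \<Rightarrow> bool" where
  "is_algorithm ALG \<longleftrightarrow>
     (\<forall>U. uncertainty_set U \<longrightarrow> (\<forall>p\<in>U. is_schedule (ALG U p)))"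

text \<open>
  The coercion \<open>ennreal\<close> sends negative reals to \<open>0\<close>. Since \<open>C_max\<close> and \<open>OPT\<close> are
  nonnegative, for \<open>\<alpha> < 0\<close> the condition below is implied by the one read in the extended reals.
\<close>

definition consistent :: "('i::finite, 'j::finite) alg \<Rightarrow> ('i, 'j) scenario set \<Rightarrow> real \<Rightarrow> bool" where
  "consistent ALG U \<alpha> \<longleftrightarrow> (\<forall>p\<in>U. C_max (ALG U p) p \<le> ennreal \<alpha> * OPT p)"

text \<open>
  Division on \<^typ>\<open>ennreal\<close> yields \<open>0 / 0 = 0\<close> and \<open>\<infinity> / \<infinity> = 0\<close>, whereas the prediction
  error uses the value \<open>1\<close> in both cases.
\<close>

definition ratio :: "ennreal \<Rightarrow> ennreal \<Rightarrow> ennreal" where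
  "ratio x y = (if x = 0 \<and> y = 0 \<or> x = \<infinity> \<and> y = \<infinity> then 1 else x / y)"

lemma ratio_0_0: "ratio 0 0 = 1"
  by (simp add: ratio_def)

lemma ratio_pos_0: "0 < x \<Longrightarrow> ratio x 0 = \<infinity>"
  by (simp add: ratio_def ennreal_divide_zero)

lemma ratio_top_top: "ratio \<infinity> \<infinity> = 1"
  by (simp add: ratio_def)

lemma ratio_ennreal: "0 \<le> x \<Longrightarrow> 0 < y \<Longrightarrow> ratio (ennreal x) (ennreal y) = ennreal (x / y)"
  by (simp add: ratio_def divide_ennreal)

text \<open>The first argument is the predicted scenario, the second the true one.\<close>

definition prediction_error ::
  "('i::finite, 'j::finite) scenario \<Rightarrow> ('i, 'j) scenario \<Rightarrow> ennreal" where
  "prediction_error p q =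
     (MAX (i, j)\<in>UNIV. max (ratio (q i j) (p i j)) (ratio (p i j) (q i j)))"

text \<open>The smoothness factor is a function of the prediction error.\<close>

definition smooth ::
  "('i::finite, 'j::finite) alg \<Rightarrow> ('i, 'j) scenario set \<Rightarrow> (real \<Rightarrow> real) \<Rightarrow> bool" where
  "smooth ALG U f \<longleftrightarrow>
     (\<forall>\<eta>\<ge>1. \<forall>q\<in>U. \<forall>p\<in>U. prediction_error p q = ennreal \<eta> \<longrightarrow>
        C_max (ALG U p) q \<le> ennreal (f \<eta>) * OPT q)"

end

theory Submission
  imports Defs
begin

text \<open>
  A prediction error of \<open>\<eta>\<close> bounds \<open>p\<close> and \<open>q\<close> entrywise by \<open>\<eta>\<close> times one another. As
  \<open>C_max\<close> is monotone and homogeneous in the scenario, each exchange of \<open>p\<close> and \<open>q\<close> costs one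
  factor \<open>\<eta>\<close>: one for the cost of the computed schedule, one for the optimum.
\<close>

lemma le_mult_if_ratio_le:
  assumes "ratio x y \<le> ennreal c" "1 \<le> c"
  shows "x \<le> ennreal c * y"
proof -
  have c0: "ennreal c \<noteq> 0"
    using assms(2) by simp
  show ?thesis
  proof (cases "y = 0 \<or> y = \<infinity>")
    \<comment> \<open>If y = 0, a positive x would have ratio \<infinity>, above the finite bound,
      so x = 0. If y = \<infinity>, the right-hand side is \<infinity> because c is nonzero.\<close>
    case True
    then show ?thesis
      using assms c0
      by (auto simp: ratio_def ennreal_divide_zero ennreal_mult_top top_unique split: if_splits)
  next
    case False
    then have "x / y \<le> ennreal c"
      using assms(1) by (simp add: ratio_def)
    then have "x / y * y \<le> ennreal c * y"
      by (rule mult_right_mono) simp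
    moreover have "x / y * y = x"
      using False by (simp add: ennreal_divide_times ennreal_times_divide less_top
          mult_divide_eq_ennreal)
    ultimately show ?thesis
      by simp
  qed
qed

lemma ratio_le_prediction_error:
  "ratio (q i j) (p i j) \<le> prediction_error p q"
  "ratio (p i j) (q i j) \<le> prediction_error p q"
proof -
  have "max (ratio (q i j) (p i j)) (ratio (p i j) (q i j)) \<le> prediction_error p q"
    unfolding prediction_error_def by (rule Max_ge) (auto intro: rev_image_eqI[of "(i, j)"])
  then show "ratio (q i j) (p i j) \<le> prediction_error p q"
    "ratio (p i j) (q i j) \<le> prediction_error p q"
    by simp_all
qed

text \<open>The load of a machine is a sum of entries, so c factors out of it by distributivity; the
  maximum over machines preserves the bound.\<close>

lemma C_max_le_mult:
  assumes "\<And>i j. q i j \<le> c * p i j"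
  shows "C_max S q \<le> c * C_max S p"
proof -
  have "(\<Sum>j\<in>S i. q i j) \<le> c * C_max S p" for i
  proof -
    have "(\<Sum>j\<in>S i. q i j) \<le> c * (\<Sum>j\<in>S i. p i j)"
      unfolding sum_distrib_left by (rule sum_mono) (rule assms)
    also have "\<dots> \<le> c * C_max S p"
      unfolding C_max_def by (intro mult_left_mono Max_ge) auto
    finally show ?thesis .
  qed
  then show ?thesis
    by (subst C_max_def) auto
qed

text \<open>Ensures that the minimum in \<open>OPT\<close> ranges over a nonempty set and is thus
  attained. The witness puts all jobs on one arbitrary machine.\<close>

lemma ex_schedule: "\<exists>S :: ('i, 'j) schedule. is_schedule S"
proof
  show "is_schedule (\<lambda>i::'i. if i = undefined then UNIV else {} :: 'j set)"
    by (auto simp: is_schedule_def disjoint_family_on_def)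
qed

lemma OPT_le: "is_schedule S \<Longrightarrow> OPT q \<le> C_max S q"
  unfolding OPT_def by (rule Min_le) auto

lemma OPT_attained: "\<exists>S. is_schedule S \<and> OPT q = C_max S q"
proof -
  have "OPT q \<in> (\<lambda>S. C_max S q) ` {S. is_schedule S}"
    unfolding OPT_def using ex_schedule by (intro Min_in) auto
  then show ?thesis
    by auto
qed

text \<open>Schedules do not depend on the scenario, so an optimal schedule for q also competes in
  the minimum for p.\<close>

lemma OPT_le_mult:
  assumes "\<And>i j. p i j \<le> c * q i j"
  shows "OPT p \<le> c * OPT q"
proof -
  obtain S where "is_schedule S" "OPT q = C_max S q"
    using OPT_attained by blast
  then show ?thesis
    using OPT_le[of S p] C_max_le_mult[of p c q S, OF assms] by simp
qed

theorem lemma2: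
  fixes U :: "('i::finite, 'j::finite) scenario set"
    and ALG :: "('i, 'j) alg"
    and \<alpha> :: real
  assumes "uncertainty_set U"
    and "is_algorithm ALG"
    and "consistent ALG U \<alpha>"
  shows "smooth ALG U (\<lambda>\<eta>. \<eta>\<^sup>2 * \<alpha>)"
  unfolding smooth_def
proof (intro allI ballI impI)
  fix \<eta> :: real and q p
  assume \<eta>: "1 \<le> \<eta>" and "q \<in> U" "p \<in> U" and err: "prediction_error p q = ennreal \<eta>"
  have qp: "q i j \<le> ennreal \<eta> * p i j" and pq: "p i j \<le> ennreal \<eta> * q i j" for i j
    using ratio_le_prediction_error[where p = p and q = q] \<eta> unfolding err
    by (simp_all add: le_mult_if_ratio_le)
  have "C_max (ALG U p) q \<le> ennreal \<eta> * C_max (ALG U p) p"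
    using qp by (rule C_max_le_mult)
  also have "\<dots> \<le> ennreal \<eta> * (ennreal \<alpha> * OPT p)"
    using assms(3) \<open>p \<in> U\<close> by (intro mult_left_mono) (auto simp: consistent_def)
  also have "\<dots> \<le> ennreal \<eta> * (ennreal \<alpha> * (ennreal \<eta> * OPT q))"
    using pq by (intro mult_left_mono OPT_le_mult) auto
  also have "\<dots> = ennreal (\<eta>\<^sup>2 * \<alpha>) * OPT q"
    \<comment> \<open>The sign of \<alpha> is unknown, so the product is split with
      \<open>ennreal_mult'\<close>, which only asks that the first factor
      \<open>\<eta>\<^sup>2\<close> be nonnegative.\<close>
    using \<eta> by (simp only: ennreal_mult'[of "\<eta>\<^sup>2"] zero_le_power2)
      (simp add: ennreal_mult power2_eq_square ac_simps)
  finally show "C_max (ALG U p) q \<le> ennreal (\<eta>\<^sup>2 * \<alpha>) * OPT q" .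
qed

end
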